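(* For $T=\dfrac{1}{a}\cdot\dfrac{\gamma\theta^2k^2}{\epsilon}$ with constant $a>2\gamma$, there exists a parameter setting (data set size $N$, sample size sequence $\{s_i\}_{i=0}^{T-1}$, and $\epsilon,\delta,\sigma>0$, with $k,\theta,\gamma$ the quantities determined by them as defined in the context) that satisfies all of the conditions 1. $\sigma=\sqrt{2(\epsilon+\ln(1/\delta))/\epsilon}$ with $\delta\le 1/N$ and $\epsilon<0.5$, 2. $N\ge 10000$ and $\theta\le 6.85$, 3. $(2/e)^2\cdot k^2\ge \frac12+\ln(1/\delta)$, (but, by the choice of $T$, not the condition $T\ge \gamma\theta^2k^2/\epsilon$) such that $(\epsilon,\delta)$-differential privacy of the DP-SGD algorithm, run with these parameters, is violated.
   Context: **Parameters.** $N$ is the size of the client's data set, $T$ the number of rounds, and $\{s_i\}_{i=0}^{T-1}$ the sample size sequence. Set $$K=\sum_{i=0}^{T-1}s_i,\qquad k=\frac KN,\qquad \bar s=\frac1T\sum_{i=0}^{T-1}s_i=\frac KT,\qquad s_{max}=\max\{s_0,\dots,s_{T-1}\},\qquad\theta=\frac{s_{max}}{\bar s}.$$ $\gamma$ is the smallest solution satisfying $$\gamma\;\ge\;\frac{2}{1-\bar\alpha}+\frac{2^4\cdot\bar\alpha}{1-\bar\alpha}\left(\frac{\sigma}{(1-\sqrt{\bar\alpha})^2}+\frac{1}{\sigma(1-\bar\alpha)-2e\sqrt{\bar\alpha}}\cdot\frac{e^3}{\sigma}\right)e^{3/\sigma^2}\quad\text{with }\bar\alpha=\frac{\epsilon}{\gamma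 k},$$ where $\gamma>0$ is restricted to values with $\bar\alpha<1$ and $\sigma(1-\bar\alpha)-2e\sqrt{\bar\alpha}>0$. One has $\gamma=2+O(\bar\alpha)$, which is close to $2$ for small $\bar\alpha$. **Background.** If conditions 1–3 of the claim hold together with $T\ge\gamma\theta^2k^2/\epsilon$, then the DP-SGD algorithm is $(\epsilon,\delta)$-differentially private; the claim concerns to what extent this lower bound on $T$ can be relaxed. **Adjacency and differential privacy.** Two data sets $d,d'$ are adjacent if one has exactly one extra element compared to the other. A randomized mechanism $\mathcal M$ is $(\epsilon,\delta)$-differentially private if for any adjacent $d,d'$ and any set $S$ of outputs, $\Pr[\mathcal M(d)\in S]\le e^{\epsilon}\Pr[\mathcal M(d')\in S]+\delta$. **Clipping.** For a constant $C>0$ and a vector $x$, $[x]_C=x/\max\{1,\|x\|/C\}$. **DP-SGD algorithm.** Input: a client's data set $d$ of size $N$. Parameters: number of rounds $T$, sample sizes $s_0,\dots,s_{T-1}$, clipping constant $C>0$, noise parameter $\sigma>0$, and a loss $f(w,\xi)$ with gradient $\nabla f(w,\xi)$ in $w$. For $i=0,\dots,T-1$: 1. The client receives the current global model $\hat w$ from a server (computed from the previously sent updates). 2. The client draws a random sample $J_i\subseteq d$ by including each element of $d$ with probability $s_i/N$ (so the sample size is $s_i$ in expectation). 3. The client computes $U_i=\sum_{\xi\in J_i}[\nabla f(\hat w,\xi)]_C+n_i$ with fresh Gaussian noise $n_i\sim\mathcal N(0,C^2\sigma^2\mathbf I)$ and sends $(i,U_i)$ to the server. The output of the mechanism is the collection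 of updates $U_0,\dots,U_{T-1}$ sent to the server. *)

theory Defs
  imports "HOL-Probability.Probability"
begin

definition total_samples :: "nat \<Rightarrow> (nat \<Rightarrow> nat) \<Rightarrow> real" where
  "total_samples T s = (\<Sum>i<T. real (s i))"

definition epochs :: "nat \<Rightarrow> nat \<Rightarrow> (nat \<Rightarrow> nat) \<Rightarrow> real" where
  "epochs N T s = total_samples T s / real N"

definition mean_sample :: "nat \<Rightarrow> (nat \<Rightarrow> nat) \<Rightarrow> real" where
  "mean_sample T s = total_samples T s / real T"

definition max_sample :: "nat \<Rightarrow> (nat \<Rightarrow> nat) \<Rightarrow> nat" where
  "max_sample T s = Max (s ` {..<T})"

definition theta :: "nat \<Rightarrow> (nat \<Rightarrow> nat) \<Rightarrow> real" where
  "theta T s = real (max_sample T s) / mean_sample T s"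

definition gamma_bound :: "real \<Rightarrow> real \<Rightarrow> real" where
  "gamma_bound \<sigma> \<alpha> =
     2 / (1 - \<alpha>) +
     2 ^ 4 * \<alpha> / (1 - \<alpha>) *
       (\<sigma> / (1 - sqrt \<alpha>)\<^sup>2 +
        1 / (\<sigma> * (1 - \<alpha>) - 2 * exp 1 * sqrt \<alpha>) * (exp 3 / \<sigma>)) *
       exp (3 / \<sigma>\<^sup>2)"

definition gamma_solution :: "real \<Rightarrow> real \<Rightarrow> real \<Rightarrow> real \<Rightarrow> bool" where
  "gamma_solution \<epsilon> k \<sigma> \<gamma> \<longleftrightarrow>
     (let \<alpha> = \<epsilon> / (\<gamma> * k) in
        \<gamma> > 0 \<and> \<alpha> < 1 \<and> \<sigma> * (1 - \<alpha>) - 2 * exp 1 * sqrt \<alpha> > 0 \<and>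
        \<gamma> \<ge> gamma_bound \<sigma> \<alpha>)"

definition is_gamma :: "real \<Rightarrow> real \<Rightarrow> real \<Rightarrow> real \<Rightarrow> bool" where
  "is_gamma \<epsilon> k \<sigma> \<gamma> \<longleftrightarrow>
     gamma_solution \<epsilon> k \<sigma> \<gamma> \<and> (\<forall>\<gamma>'. gamma_solution \<epsilon> k \<sigma> \<gamma>' \<longrightarrow> \<gamma> \<le> \<gamma>')"

text \<open>
  Every solution exceeds 2, and it approaches 2 as \<open>\<alpha>\<close> tends to 0. So a constant \<open>a\<close> can satisfy
  \<open>a > 2 * \<gamma>\<close> for some setting only if \<open>a > 4\<close>.
\<close>

lemma gamma_solution_gt_2:
  assumes "gamma_solution \<epsilon> k \<sigma> \<gamma>" "\<epsilon> > 0" "k > 0" "\<sigma> > 0"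
  shows "\<gamma> > 2"
proof -
  define \<alpha> where "\<alpha> = \<epsilon> / (\<gamma> * k)"
  have *: "\<gamma> > 0" "\<alpha> < 1" "\<sigma> * (1 - \<alpha>) - 2 * exp 1 * sqrt \<alpha> > 0" "\<gamma> \<ge> gamma_bound \<sigma> \<alpha>"
    using assms(1) by (simp_all add: gamma_solution_def Let_def \<alpha>_def)
  have "\<alpha> > 0" using assms * by (simp add: \<alpha>_def)
  have "0 \<le> 2 ^ 4 * \<alpha> / (1 - \<alpha>) *
       (\<sigma> / (1 - sqrt \<alpha>)\<^sup>2 +
        1 / (\<sigma> * (1 - \<alpha>) - 2 * exp 1 * sqrt \<alpha>) * (exp 3 / \<sigma>)) * exp (3 / \<sigma>\<^sup>2)"
    using * \<open>\<alpha> > 0\<close> \<open>\<sigma> > 0\<close>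
    by (intro mult_nonneg_nonneg add_nonneg_nonneg divide_nonneg_nonneg) auto
  moreover have "2 / (1 - \<alpha>) > 2" using * \<open>\<alpha> > 0\<close> by (simp add: field_simps)
  ultimately show ?thesis using *(4) unfolding gamma_bound_def by linarith
qed

text \<open>
  A data set is a finite set of records. The client's data set has \<open>N\<close> elements, so one member of the
  pair has size \<open>N\<close>; the other one has one element more or one element fewer.
\<close>

definition adjacent :: "'x set \<Rightarrow> 'x set \<Rightarrow> bool" where
  "adjacent d d' \<longleftrightarrow> finite d \<and> finite d' \<and>
     (\<exists>x. (x \<notin> d \<and> d' = insert x d) \<or> (x \<notin> d' \<and> d = insert x d'))"

definition differentially_private ::
    "nat \<Rightarrow> real \<Rightarrow> real \<Rightarrow> ('x set \<Rightarrow> 'o measure) \<Rightarrow> bool" where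
  "differentially_private N \<epsilon> \<delta> M \<longleftrightarrow>
     (\<forall>d d'. adjacent d d' \<and> (card d = N \<or> card d' = N) \<longrightarrow>
        (\<forall>S \<in> sets (M d). measure (M d) S \<le> exp \<epsilon> * measure (M d') S + \<delta>))"

definition clip :: "real \<Rightarrow> 'w::euclidean_space \<Rightarrow> 'w" where
  "clip C x = x /\<^sub>R max 1 (norm x / C)"

text \<open>The normal distribution with mean 0 and covariance matrix \<open>\<tau>\<^sup>2\<close> times the identity.\<close>

definition gaussian_noise :: "real \<Rightarrow> 'w::euclidean_space measure" where
  "gaussian_noise \<tau> = density lborel (\<lambda>x. ennreal (\<Prod>b\<in>Basis. normal_density 0 \<tau> (x \<bullet> b)))"

text \<open>
  An outcome \<open>\<omega>\<close> gives for each round \<open>i\<close> a pair: \<open>fst (\<omega> i)\<close> tells which records are sampled, and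
  \<open>snd (\<omega> i)\<close> is the noise. The global model of round \<open>i\<close> is \<open>server i h\<close>, where \<open>h\<close> holds the
  updates \<open>U\<^sub>0, \<dots>, U\<^sub>i\<^sub>-\<^sub>1\<close> at the indices below \<open>i\<close>.
\<close>

primrec updates ::
    "real \<Rightarrow> ('w \<Rightarrow> 'x \<Rightarrow> 'w::euclidean_space) \<Rightarrow> (nat \<Rightarrow> (nat \<Rightarrow> 'w) \<Rightarrow> 'w) \<Rightarrow> 'x set \<Rightarrow>
     (nat \<Rightarrow> ('x \<Rightarrow> bool) \<times> 'w) \<Rightarrow> nat \<Rightarrow> (nat \<Rightarrow> 'w)" where
  "updates C grad server d \<omega> 0 = (\<lambda>_. undefined)"
| "updates C grad server d \<omega> (Suc i) =
     (let h = updates C grad server d \<omega> i;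
          w = server i h;
          J = {\<xi> \<in> d. fst (\<omega> i) \<xi>}
      in h(i := (\<Sum>\<xi>\<in>J. clip C (grad w \<xi>)) + snd (\<omega> i)))"

text \<open>
  The joint law of the \<open>T\<close> updates. The sampling rate \<open>s i / N\<close> is a fixed parameter, which does not
  change when the mechanism is run on an adjacent data set.
\<close>

definition dp_sgd ::
    "nat \<Rightarrow> nat \<Rightarrow> (nat \<Rightarrow> nat) \<Rightarrow> real \<Rightarrow> real \<Rightarrow> ('w \<Rightarrow> 'x \<Rightarrow> 'w::euclidean_space) \<Rightarrow>
     (nat \<Rightarrow> (nat \<Rightarrow> 'w) \<Rightarrow> 'w) \<Rightarrow> 'x set \<Rightarrow> (nat \<Rightarrow> 'w) measure" where
  "dp_sgd N T s C \<sigma> grad server d =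
     distr
       (\<Pi>\<^sub>M i\<in>{..<T}. (\<Pi>\<^sub>M \<xi>\<in>d. measure_pmf (bernoulli_pmf (real (s i) / real N)))
                      \<Otimes>\<^sub>M gaussian_noise (C * \<sigma>))
       (\<Pi>\<^sub>M i\<in>{..<T}. borel)
       (\<lambda>\<omega>. updates C grad server d \<omega> T)"

text \<open>
  No measurability of \<open>grad\<close> is required: each component of the gradient of a differentiable function
  is a pointwise limit of continuous difference quotients, hence Borel.
\<close>

definition is_loss_gradient ::
    "('w \<Rightarrow> 'x \<Rightarrow> real) \<Rightarrow> ('w \<Rightarrow> 'x \<Rightarrow> 'w::euclidean_space) \<Rightarrow> bool" where
  "is_loss_gradient f grad \<longleftrightarrow> (\<forall>w \<xi>. GDERIV (\<lambda>v. f v \<xi>) w :> grad w \<xi>)"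

definition is_server :: "(nat \<Rightarrow> (nat \<Rightarrow> 'w) \<Rightarrow> 'w::euclidean_space) \<Rightarrow> bool" where
  "is_server server \<longleftrightarrow> (\<forall>i. server i \<in> (\<Pi>\<^sub>M j\<in>{..<i}. borel) \<rightarrow>\<^sub>M borel)"

text \<open>
  Privacy of the algorithm is a claim about all losses and all servers, so a single choice of these
  for which the guarantee fails violates it.
\<close>

definition dp_sgd_private ::
    "'w::euclidean_space itself \<Rightarrow> 'x itself \<Rightarrow> nat \<Rightarrow> nat \<Rightarrow> (nat \<Rightarrow> nat) \<Rightarrow> real \<Rightarrow> real \<Rightarrow>
     real \<Rightarrow> real \<Rightarrow> bool" where
  "dp_sgd_private _ _ N T s C \<sigma> \<epsilon> \<delta> \<longleftrightarrow>
     (\<forall>(f :: 'w \<Rightarrow> 'x \<Rightarrow> real) grad server.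
        is_loss_gradient f grad \<and> is_server server \<longrightarrow>
        differentially_private N \<epsilon> \<delta> (dp_sgd N T s C \<sigma> grad server))"

end

theory Submission
  imports Defs "HOL-Real_Asymp.Real_Asymp"
begin

text \<open>
  Constant sample sizes with sampling rate \<open>q = 1 / p\<^sup>3\<close>, \<open>T = p\<^sup>6\<close> rounds and noise \<open>\<sigma> = p\<^sup>2\<close> are used.
  Then \<open>k = p\<^sup>3\<close> and \<open>\<theta> = 1\<close>. The equation for \<open>T\<close> forces \<open>\<alpha> = q / a\<close>, so \<open>\<gamma>\<close> is an explicit value
  of \<open>gamma_bound\<close>, which tends to 2 since \<open>\<sigma> * \<alpha>\<close> tends to 0, and \<open>\<epsilon> = \<gamma> / a\<close>. Solving the formula
  for \<open>\<sigma>\<close> gives \<open>ln (1 / \<delta>) = \<epsilon> * (p\<^sup>4 - 2) / 2\<close>.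

  Only one record has a nonzero gradient, of norm \<open>C\<close> in a basis direction. Summing the updates in
  that direction gives without the record a centred normal variable of standard deviation
  \<open>C * \<sigma> * sqrt T\<close>. On the event that the sum exceeds \<open>u = 5 / 4 * \<epsilon> * \<sigma>\<close> standard deviations, the
  likelihood ratio is at least \<open>exp (5 / 4 * \<epsilon> - 1 / (2 * p))\<close>, which beats \<open>exp \<epsilon>\<close>, while the
  probability of the event is about \<open>exp (- u\<^sup>2 / 2)\<close>; this exceeds \<open>\<delta>\<close>, which is about
  \<open>exp (- \<epsilon> * \<sigma>\<^sup>2 / 2)\<close>, because \<open>(5 / 4 * \<epsilon>)\<^sup>2 < \<epsilon>\<close> for \<open>\<epsilon> \<le> 1 / 2\<close>.
\<close>

section \<open>Monotonicity of the bound that defines \<gamma>\<close>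

text \<open>As \<alpha> grows to \<beta>, every numerator grows or stays fixed and every denominator
  shrinks while staying positive; positivity at \<beta> is the strongest case and covers all smaller
  values.\<close>

lemma gamma_bound_mono:
  assumes "0 \<le> \<alpha>" "\<alpha> \<le> \<beta>" "\<beta> < 1" "0 < \<sigma>" "\<sigma> * (1 - \<beta>) - 2 * exp 1 * sqrt \<beta> > 0"
  shows "gamma_bound \<sigma> \<alpha> \<le> gamma_bound \<sigma> \<beta>"
proof -
  have "sqrt \<alpha> \<le> sqrt \<beta>" "sqrt \<beta> < 1" using assms by auto
  moreover have "\<sigma> * (1 - \<beta>) - 2 * exp 1 * sqrt \<beta> \<le> \<sigma> * (1 - \<alpha>) - 2 * exp 1 * sqrt \<alpha>"
    using assms calculation by (intro diff_mono mult_left_mono) auto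
  ultimately show ?thesis
    unfolding gamma_bound_def using assms
    by (intro add_mono mult_mono frac_le power_mono) (auto intro!: add_nonneg_nonneg)
qed

section \<open>Product measures and Gaussian tails\<close>

text \<open>Domination of \<open>r * M\<close> by \<open>M'\<close> passes to finite products, one
  coordinate at a time by Fubini. A lower bound \<open>r\<close> for the density suffices, so a
  convenient minorant can replace the mixture density of one round.\<close>

lemma nn_integral_PiM_ge_density:
  fixes M M' :: "'a measure" and r :: "'a \<Rightarrow> ennreal"
  assumes "finite I" and "prob_space M" and "prob_space M'"
    and sets [measurable_cong]: "sets M' = sets M" and r [measurable]: "r \<in> borel_measurable M"
    and le: "\<And>h. h \<in> borel_measurable M \<Longrightarrow> (\<integral>\<^sup>+y. h y * r y \<partial>M) \<le> (\<integral>\<^sup>+y. h y \<partial>M')"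
    and f: "f \<in> borel_measurable (\<Pi>\<^sub>M i\<in>I. M)"
  shows "(\<integral>\<^sup>+x. f x * (\<Prod>i\<in>I. r (x i)) \<partial>(\<Pi>\<^sub>M i\<in>I. M)) \<le> (\<integral>\<^sup>+x. f x \<partial>(\<Pi>\<^sub>M i\<in>I. M'))"
  using \<open>finite I\<close> f
proof (induction I arbitrary: f rule: finite_induct)
  case empty
  then show ?case by (simp add: PiM_empty nn_integral_count_space_finite)
next
  case (insert i I)
  interpret M: prob_space M by fact
  interpret M': prob_space M' by fact
  interpret P: product_sigma_finite "\<lambda>_. M" ..
  interpret P': product_sigma_finite "\<lambda>_. M'" ..
  have sets_P: "sets (\<Pi>\<^sub>M i\<in>insert i I. M') = sets (\<Pi>\<^sub>M i\<in>insert i I. M)"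
    "sets (\<Pi>\<^sub>M i\<in>I. M') = sets (\<Pi>\<^sub>M i\<in>I. M)"
    using sets by (auto intro!: sets_PiM_cong)
  note [measurable] = insert.prems
  have f' [measurable]: "f \<in> borel_measurable (\<Pi>\<^sub>M i\<in>insert i I. M')"
    using insert.prems sets_P measurable_cong_sets by blast
  \<comment> \<open>\<open>g\<close> integrates out the new coordinate with weight \<open>r\<close>.
    The induction hypothesis then moves the other coordinates to \<open>M'\<close>, and
    \<open>le\<close> finally moves this one.\<close>
  define g where "g x = (\<integral>\<^sup>+y. f (x(i := y)) * r y \<partial>M)" for x
  have g [measurable]: "g \<in> borel_measurable (\<Pi>\<^sub>M i\<in>I. M)"
    unfolding g_def by measurable
  have "(\<integral>\<^sup>+x. f x * (\<Prod>j\<in>insert i I. r (x j)) \<partial>(\<Pi>\<^sub>M i\<in>insert i I. M)) =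
      (\<integral>\<^sup>+x. \<integral>\<^sup>+y. f (x(i := y)) * (\<Prod>j\<in>insert i I. r ((x(i := y)) j)) \<partial>M \<partial>(\<Pi>\<^sub>M i\<in>I. M))"
    by (rule P.product_nn_integral_insert) (use insert.hyps in auto)
  also have "\<dots> = (\<integral>\<^sup>+x. \<integral>\<^sup>+y. f (x(i := y)) * r y * (\<Prod>j\<in>I. r (x j)) \<partial>M \<partial>(\<Pi>\<^sub>M i\<in>I. M))"
  proof -
    have "(\<Prod>j\<in>I. r ((x(i := y)) j)) = (\<Prod>j\<in>I. r (x j))" for x y
      using insert.hyps by (intro prod.cong) auto
    then show ?thesis using insert.hyps by (simp add: mult.assoc)
  qed
  also have "\<dots> = (\<integral>\<^sup>+x. g x * (\<Prod>j\<in>I. r (x j)) \<partial>(\<Pi>\<^sub>M i\<in>I. M))"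
    unfolding g_def by (intro nn_integral_cong nn_integral_multc) measurable
  also have "\<dots> \<le> (\<integral>\<^sup>+x. g x \<partial>(\<Pi>\<^sub>M i\<in>I. M'))"
    by (rule insert.IH) fact
  also have "\<dots> \<le> (\<integral>\<^sup>+x. \<integral>\<^sup>+y. f (x(i := y)) \<partial>M' \<partial>(\<Pi>\<^sub>M i\<in>I. M'))"
    unfolding g_def using sets_P(2)
    by (intro nn_integral_mono le)
       (auto intro!: measurable_compose[OF _ insert.prems] measurable_fun_upd simp: space_PiM sets_eq_imp_space_eq[OF sets])
  also have "\<dots> = (\<integral>\<^sup>+x. f x \<partial>(\<Pi>\<^sub>M i\<in>insert i I. M'))"
    by (rule P'.product_nn_integral_insert[symmetric]) (use insert.hyps in auto)
  finally show ?case .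
qed

text \<open>The density is a product over \<open>Basis\<close>, so integrals of products factor into
  one-dimensional ones. For the marginal, \<open>h\<close> is put into the factor of
  \<open>b\<close> and 1 into all others, each of which then integrates to 1.\<close>

lemma gaussian_noise_prob_and_marginal:
  fixes b :: "'w::euclidean_space"
  assumes "\<tau> > 0"
  shows prob_space_gaussian_noise: "prob_space (gaussian_noise \<tau> :: 'w measure)"
    and nn_integral_gaussian_noise_inner: "\<And>h. b \<in> Basis \<Longrightarrow> h \<in> borel_measurable borel \<Longrightarrow>
      (\<integral>\<^sup>+x. h (x \<bullet> b) \<partial>gaussian_noise \<tau>) = (\<integral>\<^sup>+y. h y \<partial>density lborel (normal_density 0 \<tau>))"
proof -
  have 1: "(\<integral>\<^sup>+y. normal_density 0 \<tau> y \<partial>lborel) = 1"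
    using prob_space.emeasure_space_1[OF prob_space_normal_density[OF assms]]
    by (simp add: emeasure_density)
  have "emeasure (gaussian_noise \<tau> :: 'w measure) UNIV =
      (\<integral>\<^sup>+x. (\<Prod>b\<in>Basis. ennreal (normal_density 0 \<tau> (x \<bullet> b))) \<partial>(lborel::'w measure))"
    unfolding gaussian_noise_def by (simp add: emeasure_density prod_ennreal)
  also have "\<dots> = 1"
    by (subst nn_integral_lborel_prod) (simp_all add: 1)
  finally show "prob_space (gaussian_noise \<tau> :: 'w measure)"
    by (intro prob_spaceI) (simp add: gaussian_noise_def)
  fix h :: "real \<Rightarrow> ennreal" assume b: "b \<in> Basis" and [measurable]: "h \<in> borel_measurable borel"
  have "(\<integral>\<^sup>+x. h (x \<bullet> b) \<partial>gaussian_noise \<tau>) =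
      (\<integral>\<^sup>+x. (\<Prod>b'\<in>Basis. ennreal (normal_density 0 \<tau> (x \<bullet> b')) * (if b' = b then h (x \<bullet> b') else 1)) \<partial>lborel)"
    unfolding gaussian_noise_def using b
    by (simp add: nn_integral_density prod_ennreal[symmetric] prod.distrib)
  also have "\<dots> = (\<Prod>b'\<in>Basis. (\<integral>\<^sup>+y. ennreal (normal_density 0 \<tau> y) * (if b' = b then h y else 1) \<partial>lborel))"
    by (rule nn_integral_lborel_prod) auto
  also have "\<dots> = (\<Prod>b'\<in>Basis. if b' = b then (\<integral>\<^sup>+y. h y \<partial>density lborel (normal_density 0 \<tau>)) else 1)"
    by (intro prod.cong refl) (auto simp: nn_integral_density 1)
  also have "\<dots> = (\<integral>\<^sup>+y. h y \<partial>density lborel (normal_density 0 \<tau>))"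
    using b by simp
  finally show "(\<integral>\<^sup>+x. h (x \<bullet> b) \<partial>gaussian_noise \<tau>) = (\<integral>\<^sup>+y. h y \<partial>density lborel (normal_density 0 \<tau>))" .
qed

lemma indep_vars_PiM_components:
  assumes "finite I" "I \<noteq> {}" "\<And>i. i \<in> I \<Longrightarrow> prob_space (M i)"
  shows "prob_space.indep_vars (PiM I M) M (\<lambda>i x. x i) I"
proof -
  interpret prob_space "PiM I M" by (intro prob_space_PiM assms)
  have "distr (PiM I M) (PiM I M) (\<lambda>x. \<lambda>i\<in>I. x i) = distr (PiM I M) (PiM I M) (\<lambda>x. x)"
    by (intro distr_cong) (auto simp: space_PiM)
  also have "\<dots> = PiM I M" by (rule distr_id)
  also have "\<dots> = (\<Pi>\<^sub>M i\<in>I. distr (PiM I M) (M i) (\<lambda>x. x i))"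
    by (intro PiM_cong refl distr_PiM_component[symmetric] assms)
  finally show ?thesis
    using assms by (subst indep_vars_iff_distr_eq_PiM') auto
qed

text \<open>The sum is normal with standard deviation \<open>w = sqrt T * \<tau>\<close>. On the
  interval from \<open>u * w\<close> to \<open>(u + 1) * w\<close> its density is at least the value
  at the right end, so the tail contains a rectangle of width \<open>w\<close> and that
  height.\<close>

lemma normal_sum_tail_ge:
  fixes \<tau> u :: real and T :: nat
  assumes "\<tau> > 0" "u \<ge> 0" "T > 0"
  defines "P \<equiv> \<Pi>\<^sub>M i\<in>{..<T}. density lborel (normal_density 0 \<tau>)"
  shows "exp (- (u + 1)\<^sup>2 / 2) / sqrt (2 * pi) \<le>
    measure P {y \<in> space P. (\<Sum>i<T. y i) > u * (sqrt T * \<tau>)}"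
proof -
  let ?N = "density lborel (\<lambda>y. ennreal (normal_density 0 \<tau> y))"
  define w where "w = sqrt T * \<tau>"
  have "w > 0" using assms by (simp add: w_def)
  interpret N: prob_space ?N by (rule prob_space_normal_density) fact
  interpret P: prob_space P unfolding P_def by (intro prob_space_PiM N.prob_space_axioms)
  have "P.indep_vars (\<lambda>_. ?N) (\<lambda>i x. x i) {..<T}"
    unfolding P_def using \<open>T > 0\<close> by (intro indep_vars_PiM_components N.prob_space_axioms) auto
  then have indep: "P.indep_vars (\<lambda>_. borel) (\<lambda>i x. x i) {..<T}"
    by (simp add: P.indep_vars_def cong: measurable_cong_sets)
  have "distributed P lborel (\<lambda>x. x i) (normal_density 0 \<tau>)" if "i < T" for i
  proof -
    have "distr P lborel (\<lambda>x. x i) = distr P ?N (\<lambda>x. x i)" by (rule distr_cong) auto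
    also have "\<dots> = ?N"
      unfolding P_def using that by (intro distr_PiM_component N.prob_space_axioms) auto
    finally show ?thesis
      using indep that by (auto simp: distributed_def P.indep_vars_def)
  qed
  then have D: "distributed P lborel (\<lambda>x. \<Sum>i<T. x i) (normal_density 0 w)"
    using P.sum_indep_normal[of "{..<T}" "\<lambda>i x. x i" "\<lambda>_. \<tau>" "\<lambda>_. 0"] indep assms
    by (auto simp: w_def real_sqrt_mult)
  \<comment> \<open>The claimed bound is the area of this rectangle; \<open>w\<close>
    cancels.\<close>
  have "exp (- (u + 1)\<^sup>2 / 2) / sqrt (2 * pi) = normal_density 0 w ((u + 1) * w) * w"
    using \<open>w > 0\<close> by (simp add: normal_density_def power_mult_distrib real_sqrt_mult)
  then have "ennreal (exp (- (u + 1)\<^sup>2 / 2) / sqrt (2 * pi)) =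
      (\<integral>\<^sup>+y. ennreal (normal_density 0 w ((u + 1) * w)) * indicator {u * w <.. (u + 1) * w} y \<partial>lborel)"
    using \<open>w > 0\<close> by (simp add: nn_integral_cmult_indicator ennreal_mult algebra_simps)
  also have "\<dots> \<le> (\<integral>\<^sup>+y. ennreal (normal_density 0 w y) * indicator {u * w <..} y \<partial>lborel)"
  proof (intro nn_integral_mono)
    fix y
    show "ennreal (normal_density 0 w ((u + 1) * w)) * indicator {u * w <.. (u + 1) * w} y
      \<le> ennreal (normal_density 0 w y) * indicator {u * w <..} y"
    proof (cases "y \<in> {u * w <.. (u + 1) * w}")
      case True
      have "0 \<le> u * w" using \<open>w > 0\<close> assms by simp
      then have "y\<^sup>2 \<le> ((u + 1) * w)\<^sup>2" using True by (intro power_mono) auto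
      then have "normal_density 0 w ((u + 1) * w) \<le> normal_density 0 w y"
        using \<open>w > 0\<close> by (auto simp: normal_density_def intro!: divide_right_mono)
      then show ?thesis using True by (simp add: ennreal_leI)
    qed simp
  qed
  also have "\<dots> = emeasure P ((\<lambda>x. \<Sum>i<T. x i) -` {u * w <..} \<inter> space P)"
    using distributed_emeasure[OF D, of "{u * w <..}"] by simp
  also have "(\<lambda>x. \<Sum>i<T. x i) -` {u * w <..} \<inter> space P = {y \<in> space P. (\<Sum>i<T. y i) > u * w}"
    by auto
  finally show ?thesis by (simp add: P.emeasure_eq_measure w_def)
qed

section \<open>One round in which a single record matters\<close>

text \<open>The update of one round when \<open>x\<close> alone has a nonzero gradient;
  \<open>v\<close> stands for that gradient after clipping.\<close>

definition record_update ::
    "'x \<Rightarrow> 'x set \<Rightarrow> 'w::euclidean_space \<Rightarrow> ('x \<Rightarrow> bool) \<times> 'w \<Rightarrow> 'w" where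
  "record_update x d v \<omega> = (if x \<in> d \<and> fst \<omega> x then v else 0) + snd \<omega>"

lemma record_update_measurable:
  "record_update x d v \<in> borel_measurable ((\<Pi>\<^sub>M \<xi>\<in>d. measure_pmf (P \<xi>)) \<Otimes>\<^sub>M gaussian_noise \<tau>)"
proof -
  have [measurable]: "(\<lambda>g. g) \<in> borel_measurable (gaussian_noise \<tau>)"
    by (simp add: gaussian_noise_def)
  show ?thesis
  proof (cases "x \<in> d")
    case True
    then have [measurable]: "Measurable.pred (\<Pi>\<^sub>M \<xi>\<in>d. measure_pmf (P \<xi>)) (\<lambda>z. z x)"
      using measurable_component_singleton[OF True, of "\<lambda>\<xi>. measure_pmf (P \<xi>)"]
      by (simp cong: measurable_cong_sets)
    show ?thesis using True unfolding record_update_def by simp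
  qed (simp add: record_update_def[abs_def])
qed

text \<open>Of all sampling bits only that of \<open>x\<close> enters, and it is Bernoulli with
  parameter \<open>q\<close>. Conditioning on it leaves the projected noise, shifted by
  \<open>C\<close> or not: a two-component normal mixture if \<open>x\<close> is in
  \<open>d\<close>.\<close>

lemma nn_integral_record_update:
  fixes b :: "'w::euclidean_space"
  assumes "\<tau> > 0" "0 \<le> q" "q \<le> 1" and b: "b \<in> Basis" and [measurable]: "h \<in> borel_measurable borel"
  defines "N \<equiv> density lborel (normal_density 0 \<tau>)"
  shows "(\<integral>\<^sup>+\<omega>. h (record_update x d (C *\<^sub>R b) \<omega> \<bullet> b)
      \<partial>((\<Pi>\<^sub>M \<xi>\<in>d. measure_pmf (bernoulli_pmf q)) \<Otimes>\<^sub>M gaussian_noise \<tau>)) =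
    (if x \<in> d then ennreal q * (\<integral>\<^sup>+y. h (C + y) \<partial>N) + ennreal (1 - q) * (\<integral>\<^sup>+y. h y \<partial>N)
     else (\<integral>\<^sup>+y. h y \<partial>N))"
proof -
  let ?B = "\<Pi>\<^sub>M \<xi>\<in>d. measure_pmf (bernoulli_pmf q)"
  interpret G: prob_space "gaussian_noise \<tau> :: 'w measure"
    by (rule prob_space_gaussian_noise) fact
  interpret B: prob_space ?B
    by (intro prob_space_PiM measure_pmf.prob_space_axioms)
  define H where "H c = (\<integral>\<^sup>+y. h ((if c then C else 0) + y) \<partial>N)" for c
  note [measurable] = record_update_measurable[of x d "C *\<^sub>R b" "\<lambda>_. bernoulli_pmf q" \<tau>]
  have "(\<integral>\<^sup>+\<omega>. h (record_update x d (C *\<^sub>R b) \<omega> \<bullet> b) \<partial>(?B \<Otimes>\<^sub>M gaussian_noise \<tau>))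
     = (\<integral>\<^sup>+z. \<integral>\<^sup>+g. h (record_update x d (C *\<^sub>R b) (z, g) \<bullet> b) \<partial>gaussian_noise \<tau> \<partial>?B)"
    by (subst G.nn_integral_fst[symmetric]) simp_all
  also have "\<dots> = (\<integral>\<^sup>+z. \<integral>\<^sup>+g. h ((if x \<in> d \<and> z x then C else 0) + g \<bullet> b) \<partial>gaussian_noise \<tau> \<partial>?B)"
    using b by (intro nn_integral_cong) (simp add: record_update_def inner_add_left)
  also have "\<dots> = (\<integral>\<^sup>+z. H (x \<in> d \<and> z x) \<partial>?B)"
    unfolding H_def N_def
    by (intro nn_integral_cong nn_integral_gaussian_noise_inner[where b=b, OF \<open>\<tau> > 0\<close> b]) measurable
  also have "\<dots> = (if x \<in> d then (\<integral>\<^sup>+c. H c \<partial>bernoulli_pmf q) else H False)"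
  proof (cases "x \<in> d")
    case True
    have "(\<integral>\<^sup>+z. H (z x) \<partial>?B) = (\<integral>\<^sup>+c. H c \<partial>distr ?B (measure_pmf (bernoulli_pmf q)) (\<lambda>z. z x))"
      using True by (subst nn_integral_distr) auto
    also have "distr ?B (measure_pmf (bernoulli_pmf q)) (\<lambda>z. z x) = measure_pmf (bernoulli_pmf q)"
      using True by (intro distr_PiM_component measure_pmf.prob_space_axioms)
    finally show ?thesis using True by simp
  qed (simp add: B.emeasure_space_1)
  finally show ?thesis using assms(2,3) by (simp add: H_def mult.commute)
qed

text \<open>
  By convexity of \<open>exp\<close>, the density \<open>q * exp u + 1 - q\<close> of the mixture relative to the noise is at
  least \<open>exp (q * u)\<close>. Unlike the mixture, this bound turns products over rounds into sums.
\<close>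

lemma nn_integral_record_update_ge:
  fixes b :: "'w::euclidean_space"
  assumes "\<tau> > 0" "0 \<le> q" "q \<le> 1" and b: "b \<in> Basis" and [measurable]: "h \<in> borel_measurable borel"
    and "x \<in> d"
  shows "(\<integral>\<^sup>+y. h y * ennreal (exp (q * ((2 * y * C - C\<^sup>2) / (2 * \<tau>\<^sup>2)))) \<partial>density lborel (normal_density 0 \<tau>))
    \<le> (\<integral>\<^sup>+\<omega>. h (record_update x d (C *\<^sub>R b) \<omega> \<bullet> b)
      \<partial>((\<Pi>\<^sub>M \<xi>\<in>d. measure_pmf (bernoulli_pmf q)) \<Otimes>\<^sub>M gaussian_noise \<tau>))"
proof -
  let ?\<phi> = "normal_density 0 \<tau>"
  let ?r = "\<lambda>y. exp (q * ((2 * y * C - C\<^sup>2) / (2 * \<tau>\<^sup>2)))"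
  have \<phi>: "?\<phi> y * ?r y \<le> q * ?\<phi> (y - C) + (1 - q) * ?\<phi> y" for y
  proof -
    \<comment> \<open>\<open>u\<close> is the log-likelihood ratio at \<open>y\<close> between the
      noise shifted by \<open>C\<close> and the unshifted noise.\<close>
    define u where "u = (2 * y * C - C\<^sup>2) / (2 * \<tau>\<^sup>2)"
    have "- (y - C)\<^sup>2 / (2 * \<tau>\<^sup>2) = - y\<^sup>2 / (2 * \<tau>\<^sup>2) + u"
      using assms(1) by (simp add: u_def field_simps power2_eq_square)
    then have "?\<phi> (y - C) = ?\<phi> y * exp u"
      unfolding normal_density_def diff_zero by (simp only: exp_add mult.assoc)
    moreover have "exp (q * u) \<le> q * exp u + (1 - q)"
      using convex_onD[OF exp_convex, of q 0 u] assms(2,3) by simp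
    then have "?\<phi> y * exp (q * u) \<le> ?\<phi> y * (q * exp u + (1 - q))"
      by (intro mult_left_mono normal_density_nonneg)
    ultimately show ?thesis by (simp add: u_def algebra_simps)
  qed
  have shift: "(\<integral>\<^sup>+y. h (C + y) * ennreal (?\<phi> y) \<partial>lborel) = (\<integral>\<^sup>+y. h y * ennreal (?\<phi> (y - C)) \<partial>lborel)"
    by (subst nn_integral_real_affine[where c=1 and t=C and f="\<lambda>y. h y * ennreal (?\<phi> (y - C))"]) simp_all
  have "(\<integral>\<^sup>+y. h y * ennreal (?r y) \<partial>density lborel ?\<phi>) = (\<integral>\<^sup>+y. h y * ennreal (?\<phi> y * ?r y) \<partial>lborel)"
    by (subst nn_integral_density) (auto simp: ennreal_mult' mult_ac)
  also have "\<dots> \<le> (\<integral>\<^sup>+y. h y * ennreal (q * ?\<phi> (y - C) + (1 - q) * ?\<phi> y) \<partial>lborel)"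
    by (intro nn_integral_mono mult_left_mono ennreal_leI \<phi>) auto
  also have "\<dots> = (\<integral>\<^sup>+y. ennreal q * (h y * ennreal (?\<phi> (y - C))) + ennreal (1 - q) * (h y * ennreal (?\<phi> y)) \<partial>lborel)"
    using assms(2,3) by (intro nn_integral_cong) (simp add: ennreal_mult distrib_left mult_ac)
  also have "\<dots> = ennreal q * (\<integral>\<^sup>+y. h y * ennreal (?\<phi> (y - C)) \<partial>lborel) + ennreal (1 - q) * (\<integral>\<^sup>+y. h y * ennreal (?\<phi> y) \<partial>lborel)"
    by (simp add: nn_integral_add nn_integral_cmult)
  also have "\<dots> = ennreal q * (\<integral>\<^sup>+y. h (C + y) \<partial>density lborel ?\<phi>) + ennreal (1 - q) * (\<integral>\<^sup>+y. h y \<partial>density lborel ?\<phi>)"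
    by (simp add: nn_integral_density shift[symmetric] mult.commute)
  finally show ?thesis
    using assms by (subst nn_integral_record_update) auto
qed

section \<open>Reduction of DP-SGD to independent scalar updates\<close>

lemma clip_0 [simp]: "clip C 0 = 0"
  by (simp add: clip_def)

lemma clip_scaleR_Basis: "C > 0 \<Longrightarrow> b \<in> Basis \<Longrightarrow> clip C (C *\<^sub>R b) = C *\<^sub>R b"
  by (simp add: clip_def)

text \<open>The gradient ignores the model, so the feedback through \<open>server\<close> disappears
  and each update depends on its own round only. Restriction to \<open>{..<n}\<close> reproduces the
  value \<open>undefined\<close> with which \<open>updates\<close> starts.\<close>

lemma updates_single_record:
  fixes b :: "'w::euclidean_space"
  assumes "C > 0" "b \<in> Basis" "finite d"
  shows "updates C (\<lambda>_ \<xi>. if \<xi> = x then C *\<^sub>R b else 0) server d \<omega> n =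
    (\<lambda>i\<in>{..<n}. record_update x d (C *\<^sub>R b) (\<omega> i))"
proof (induction n)
  case (Suc n)
  have "(\<Sum>\<xi>\<in>{\<xi> \<in> d. z \<xi>}. clip C (if \<xi> = x then C *\<^sub>R b else 0)) =
      (if x \<in> d \<and> z x then C *\<^sub>R b else 0)" for z
  proof -
    have "(\<Sum>\<xi>\<in>{\<xi> \<in> d. z \<xi>}. clip C (if \<xi> = x then C *\<^sub>R b else 0)) =
        (\<Sum>\<xi>\<in>{\<xi> \<in> d. z \<xi>}. if x = \<xi> then C *\<^sub>R b else 0)"
      using assms by (intro sum.cong) (auto simp: clip_scaleR_Basis)
    then show ?thesis using assms by simp
  qed
  then show ?case using Suc by (auto simp: Let_def fun_eq_iff less_Suc_eq record_update_def)
qed (auto simp: fun_eq_iff)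

text \<open>The event concerns only the components along \<open>b\<close>. With constant sample size
  these are independent with common law \<open>E\<close>, so the event can be measured in a power of
  \<open>E\<close>.\<close>

lemma emeasure_dp_sgd_single_record:
  fixes b :: "'w::euclidean_space" and x :: 'x and n N T :: nat
  assumes "C > 0" "\<sigma> > 0" and b: "b \<in> Basis" and "finite d"
  defines "E \<equiv> distr ((\<Pi>\<^sub>M \<xi>\<in>d. measure_pmf (bernoulli_pmf (real n / real N))) \<Otimes>\<^sub>M gaussian_noise (C * \<sigma>)) borel
      (\<lambda>\<omega>. record_update x d (C *\<^sub>R b) \<omega> \<bullet> b)"
  shows "emeasure (dp_sgd N T (\<lambda>_. n) C \<sigma> (\<lambda>_ \<xi>. if \<xi> = x then C *\<^sub>R b else 0) server d)
       {h \<in> space (\<Pi>\<^sub>M i\<in>{..<T}. borel). (\<Sum>i<T. h i \<bullet> b) > t}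
     = emeasure (\<Pi>\<^sub>M i\<in>{..<T}. E) {y \<in> space (\<Pi>\<^sub>M i\<in>{..<T}. borel). (\<Sum>i<T. y i) > t}"
proof -
  let ?R = "(\<Pi>\<^sub>M \<xi>\<in>d. measure_pmf (bernoulli_pmf (real n / real N))) \<Otimes>\<^sub>M (gaussian_noise (C * \<sigma>) :: 'w measure)"
  let ?P = "\<Pi>\<^sub>M i\<in>{..<T}. ?R"
  let ?f = "record_update x d (C *\<^sub>R b)"
  let ?F = "\<lambda>\<omega>. ?f \<omega> \<bullet> b"
  have pR: "prob_space ?R"
    using assms by (intro prob_space_pair prob_space_PiM measure_pmf.prob_space_axioms prob_space_gaussian_noise) auto
  have f [measurable]: "?f \<in> borel_measurable ?R"
    by (rule record_update_measurable)
  have F: "?F \<in> borel_measurable ?R" by measurable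
  have pE: "prob_space E" unfolding E_def by (rule prob_space.prob_space_distr[OF pR F])
  have U: "(\<lambda>\<omega>. \<lambda>i\<in>{..<T}. ?f (\<omega> i)) \<in> ?P \<rightarrow>\<^sub>M (\<Pi>\<^sub>M i\<in>{..<T}. borel)"
    by (intro measurable_restrict measurable_compose[OF _ f] measurable_component_singleton)
  have cF: "compose {..<T} ?F \<in> ?P \<rightarrow>\<^sub>M (\<Pi>\<^sub>M i\<in>{..<T}. borel)"
    unfolding compose_def
    by (intro measurable_restrict measurable_compose[OF _ F] measurable_component_singleton)
  \<comment> \<open>Applying \<open>?F\<close> in every round pushes the product of the round
    measures to the product of the pushed-forward measures.\<close>
  have "distr ?P (\<Pi>\<^sub>M i\<in>{..<T}. E) (compose {..<T} ?F) = (\<Pi>\<^sub>M i\<in>{..<T}. distr ?R E ?F)"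
    using pR pE F by (intro distr_PiM_finite_prob_space') (auto simp: E_def)
  also have "distr ?R E ?F = E"
    unfolding E_def by (intro distr_cong) auto
  also have "distr ?P (\<Pi>\<^sub>M i\<in>{..<T}. E) (compose {..<T} ?F) = distr ?P (\<Pi>\<^sub>M i\<in>{..<T}. borel) (compose {..<T} ?F)"
    by (intro distr_cong sets_PiM_cong) (auto simp: E_def)
  finally have E: "(\<Pi>\<^sub>M i\<in>{..<T}. E) = distr ?P (\<Pi>\<^sub>M i\<in>{..<T}. borel) (compose {..<T} ?F)" by simp
  let ?A = "{h \<in> space (\<Pi>\<^sub>M i\<in>{..<T}. borel :: 'w measure). (\<Sum>i<T. h i \<bullet> b) > t}"
  let ?Y = "{y \<in> space (\<Pi>\<^sub>M i\<in>{..<T}. borel :: real measure). (\<Sum>i<T. y i) > t}"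
  have upd: "updates C (\<lambda>_ \<xi>. if \<xi> = x then C *\<^sub>R b else 0) server d \<omega> T = (\<lambda>i\<in>{..<T}. ?f (\<omega> i))" for \<omega>
    using assms by (intro updates_single_record)
  have "emeasure (dp_sgd N T (\<lambda>_. n) C \<sigma> (\<lambda>_ \<xi>. if \<xi> = x then C *\<^sub>R b else 0) server d) ?A =
      emeasure ?P ((\<lambda>\<omega>. \<lambda>i\<in>{..<T}. ?f (\<omega> i)) -` ?A \<inter> space ?P)"
    unfolding dp_sgd_def upd by (rule emeasure_distr[OF U]) measurable
  also have "(\<lambda>\<omega>. \<lambda>i\<in>{..<T}. ?f (\<omega> i)) -` ?A \<inter> space ?P = compose {..<T} ?F -` ?Y \<inter> space ?P"
    by (auto simp: space_PiM compose_def)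
  also have "emeasure ?P \<dots> = emeasure (\<Pi>\<^sub>M i\<in>{..<T}. E) ?Y"
    unfolding E by (rule emeasure_distr[OF cF, symmetric]) measurable
  finally show ?thesis .
qed

text \<open>Without the record the scalar updates are pure noise. With it, the density of each is at
  least the exponential of an affine function, so the product over rounds depends on the sum alone
  and is bounded below by a constant where the sum exceeds \<open>t\<close>.\<close>

lemma measure_dp_sgd_single_record:
  fixes b :: "'w::euclidean_space" and n N T :: nat and t :: real
    and server :: "nat \<Rightarrow> (nat \<Rightarrow> 'w) \<Rightarrow> 'w"
  assumes "C > 0" "\<sigma> > 0" and b: "b \<in> Basis" and "finite d" and "x \<notin> d" and "n \<le> N"
  defines "q \<equiv> real n / real N"
    and "P \<equiv> \<Pi>\<^sub>M i\<in>{..<T}. density lborel (normal_density 0 (C * \<sigma>))"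
    and "M \<equiv> dp_sgd N T (\<lambda>_. n) C \<sigma> (\<lambda>_ \<xi>. if \<xi> = x then C *\<^sub>R b else 0) server"
    and "A \<equiv> {h \<in> space (\<Pi>\<^sub>M i\<in>{..<T}. borel). (\<Sum>i<T. h i \<bullet> b) > t}"
  shows measure_dp_sgd_without_record: "measure (M d) A = measure P {y \<in> space P. (\<Sum>i<T. y i) > t}" (is ?without)
    and measure_dp_sgd_with_record:
      "exp (q * t / (C * \<sigma>\<^sup>2) - real T * q / (2 * \<sigma>\<^sup>2)) * measure P {y \<in> space P. (\<Sum>i<T. y i) > t}
        \<le> measure (M (insert x d)) A" (is ?with)
proof -
  let ?N = "density lborel (\<lambda>y. ennreal (normal_density 0 (C * \<sigma>) y))"
  let ?R = "\<lambda>d. (\<Pi>\<^sub>M \<xi>\<in>d. measure_pmf (bernoulli_pmf q)) \<Otimes>\<^sub>M (gaussian_noise (C * \<sigma>) :: 'w measure)"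
  let ?F = "\<lambda>d \<omega>. record_update x d (C *\<^sub>R b) \<omega> \<bullet> b"
  let ?E = "\<lambda>d. distr (?R d) borel (?F d)"
  have \<tau>: "C * \<sigma> > 0" and q: "0 \<le> q" "q \<le> 1"
    using assms by (auto simp: q_def divide_simps)
  interpret N: prob_space ?N by (rule prob_space_normal_density) fact
  interpret P: prob_space P unfolding P_def by (intro prob_space_PiM N.prob_space_axioms)
  have F: "?F d' \<in> borel_measurable (?R d')" for d'
    using record_update_measurable[of x d' "C *\<^sub>R b" "\<lambda>_. bernoulli_pmf q" "C * \<sigma>"] by measurable
  have pE: "prob_space (?E d')" for d'
    using \<tau> by (intro prob_space.prob_space_distr[OF _ F] prob_space_pair prob_space_PiM
        measure_pmf.prob_space_axioms prob_space_gaussian_noise)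
  have space_P: "space (\<Pi>\<^sub>M i\<in>{..<T}. borel) = space P"
    by (simp add: P_def space_PiM)
  have law: "emeasure (M d') A = emeasure (\<Pi>\<^sub>M i\<in>{..<T}. ?E d') {y \<in> space P. (\<Sum>i<T. y i) > t}"
    if "finite d'" for d'
    unfolding M_def A_def q_def space_P[symmetric]
    using assms that by (intro emeasure_dp_sgd_single_record)
  \<comment> \<open>Since \<open>x\<close> is not in \<open>d\<close>, no shift ever occurs.\<close>
  have "?E d = ?N"
  proof (rule measure_eqI)
    fix B assume "B \<in> sets (?E d)"
    then have [measurable]: "B \<in> sets borel" by simp
    have "emeasure (?E d) B = (\<integral>\<^sup>+y. indicator B y \<partial>?E d)"
      by simp
    also have "\<dots> = (\<integral>\<^sup>+\<omega>. indicator B (?F d \<omega>) \<partial>?R d)"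
      by (rule nn_integral_distr[OF F]) simp
    also have "\<dots> = (\<integral>\<^sup>+y. indicator B y \<partial>?N)"
      using nn_integral_record_update[OF \<tau> q b, where h = "indicator B" and x = x and d = d and C = C] \<open>x \<notin> d\<close> by simp
    finally show "emeasure (?E d) B = emeasure ?N B" by simp
  qed simp
  then have "emeasure (M d) A = emeasure P {y \<in> space P. (\<Sum>i<T. y i) > t}"
    using law[OF \<open>finite d\<close>] by (simp add: P_def)
  then show ?without by (simp add: measure_def)

  define r where "r y = ennreal (exp (q * ((2 * y * C - C\<^sup>2) / (2 * (C * \<sigma>)\<^sup>2))))" for y
  define Y where "Y = {y \<in> space P. (\<Sum>i<T. y i) > t}"
  have [measurable]: "Y \<in> sets (\<Pi>\<^sub>M i\<in>{..<T}. ?N)"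
    unfolding Y_def P_def by measurable
  \<comment> \<open>Summing the exponents of \<open>r\<close> gives
    \<open>q / (C * \<sigma>\<^sup>2)\<close> times the sum of the \<open>y i\<close>, minus
    \<open>T * q / (2 * \<sigma>\<^sup>2)\<close>; \<open>e\<close> is this value with the sum
    replaced by \<open>t\<close>.\<close>
  define e where "e = q * t / (C * \<sigma>\<^sup>2) - real T * q / (2 * \<sigma>\<^sup>2)"
  have r_prod: "ennreal (exp e) \<le> (\<Prod>i<T. r (y i))" if "y \<in> Y" for y
  proof -
    have "(\<Prod>i<T. r (y i)) = ennreal (exp (\<Sum>i<T. q * ((2 * y i * C - C\<^sup>2) / (2 * (C * \<sigma>)\<^sup>2))))"
      by (simp add: r_def prod_ennreal exp_sum)
    also have "(\<Sum>i<T. q * ((2 * y i * C - C\<^sup>2) / (2 * (C * \<sigma>)\<^sup>2))) =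
        (\<Sum>i<T. q / (C * \<sigma>\<^sup>2) * y i - q / (2 * \<sigma>\<^sup>2))"
      using \<open>C > 0\<close> \<open>\<sigma> > 0\<close>
      by (intro sum.cong refl) (simp add: divide_simps, simp add: algebra_simps power2_eq_square)
    also have "\<dots> = q / (C * \<sigma>\<^sup>2) * (\<Sum>i<T. y i) - real T * q / (2 * \<sigma>\<^sup>2)"
      by (simp add: sum_subtractf sum_distrib_left)
    finally have *: "(\<Prod>i<T. r (y i)) = ennreal (exp (q / (C * \<sigma>\<^sup>2) * (\<Sum>i<T. y i) - real T * q / (2 * \<sigma>\<^sup>2)))" .
    have "q / (C * \<sigma>\<^sup>2) * t \<le> q / (C * \<sigma>\<^sup>2) * (\<Sum>i<T. y i)"
      using that q assms by (intro mult_left_mono) (auto simp: Y_def)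
    then show ?thesis unfolding * e_def by (intro ennreal_leI) simp
  qed
  have "ennreal (exp e) * emeasure P Y = (\<integral>\<^sup>+y. ennreal (exp e) * indicator Y y \<partial>P)"
    by (subst nn_integral_cmult_indicator) (simp_all add: P_def)
  also have "\<dots> \<le> (\<integral>\<^sup>+y. indicator Y y * (\<Prod>i\<in>{..<T}. r (y i)) \<partial>P)"
    by (intro nn_integral_mono) (auto simp: r_prod split: split_indicator)
  also have "\<dots> \<le> (\<integral>\<^sup>+y. indicator Y y \<partial>(\<Pi>\<^sub>M i\<in>{..<T}. ?E (insert x d)))"
    unfolding P_def
  proof (rule nn_integral_PiM_ge_density)
    fix h :: "real \<Rightarrow> ennreal" assume "h \<in> borel_measurable ?N"
    then have "h \<in> borel_measurable borel" by simp
    then show "(\<integral>\<^sup>+y. h y * r y \<partial>?N) \<le> (\<integral>\<^sup>+y. h y \<partial>?E (insert x d))"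
      using nn_integral_record_update_ge[OF \<tau> q b, where h = h and x = x and d = "insert x d" and C = C] F
      by (simp add: nn_integral_distr r_def)
  qed (auto simp: r_def N.prob_space_axioms pE)
  also have "\<dots> = emeasure (\<Pi>\<^sub>M i\<in>{..<T}. ?E (insert x d)) Y"
  proof (rule nn_integral_indicator)
    have "sets (\<Pi>\<^sub>M i\<in>{..<T}. ?E (insert x d)) = sets (\<Pi>\<^sub>M i\<in>{..<T}. ?N)"
      by (intro sets_PiM_cong) auto
    then show "Y \<in> sets (\<Pi>\<^sub>M i\<in>{..<T}. ?E (insert x d))" by simp
  qed
  also have "\<dots> = emeasure (M (insert x d)) A"
    using law[of "insert x d"] \<open>finite d\<close> by (simp add: Y_def)
  finally have *: "ennreal (exp e) * emeasure P Y \<le> emeasure (M (insert x d)) A" .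
  interpret E: prob_space "\<Pi>\<^sub>M i\<in>{..<T}. ?E (insert x d)"
    by (intro prob_space_PiM pE)
  have "emeasure (M (insert x d)) A \<noteq> \<infinity>"
    using law[of "insert x d"] \<open>finite d\<close> E.emeasure_finite by simp
  then show ?with
    using * by (simp add: P.emeasure_eq_measure emeasure_eq_ennreal_measure ennreal_mult[symmetric] Y_def e_def)
qed

section \<open>A criterion for the violation of privacy\<close>

text \<open>Here \<open>e\<close> is the log-likelihood bound for the event that the sum exceeds
  \<open>u\<close> standard deviations. If \<open>m\<close> is its probability without the record,
  privacy forces \<open>(exp e - exp \<epsilon>) * m \<le> \<delta>\<close>, against the normal tail
  bound for \<open>m\<close>.\<close>

lemma not_dp_sgd_privateI:
  assumes "infinite (UNIV :: 'x set)" "C > 0" "\<sigma> > 0" "T > 0" "n \<le> N" "u \<ge> 0"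
  defines "q \<equiv> real n / real N"
  defines "e \<equiv> q * u * sqrt (real T) / \<sigma> - real T * q / (2 * \<sigma>\<^sup>2)"
  assumes "e \<ge> \<epsilon>" and \<delta>: "\<delta> < (exp e - exp \<epsilon>) * (exp (- (u + 1)\<^sup>2 / 2) / sqrt (2 * pi))"
  shows "\<not> dp_sgd_private TYPE('w::euclidean_space) TYPE('x) N T (\<lambda>_. n) C \<sigma> \<epsilon> \<delta>"
proof
  assume priv: "dp_sgd_private TYPE('w) TYPE('x) N T (\<lambda>_. n) C \<sigma> \<epsilon> \<delta>"
  \<comment> \<open>The smaller data set has \<open>N\<close> elements; the inequality is tested
    with \<open>insert x d\<close> on the left and \<open>d\<close> on the right.\<close>
  obtain d :: "'x set" where d: "finite d" "card d = N"
    using infinite_arbitrarily_large[OF assms(1)] by blast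
  obtain x where x: "x \<notin> d" using ex_new_if_finite[OF assms(1) d(1)] by blast
  obtain b :: 'w where b: "b \<in> Basis" using nonempty_Basis by blast
  \<comment> \<open>This is the gradient of a loss linear in the model, which vanishes for all
    records except \<open>x\<close>.\<close>
  define grad where "grad = (\<lambda>(_::'w) \<xi>. if \<xi> = x then C *\<^sub>R b else 0)"
  define server where "server = (\<lambda>(_::nat) (_ :: nat \<Rightarrow> 'w). 0 :: 'w)"
  define P where "P = (\<Pi>\<^sub>M i\<in>{..<T}. density lborel (normal_density 0 (C * \<sigma>)))"
  define t where "t = u * (sqrt T * (C * \<sigma>))"
  define A where "A = {h \<in> space (\<Pi>\<^sub>M i\<in>{..<T}. borel). (\<Sum>i<T. h i \<bullet> b) > t}"
  define M where "M = dp_sgd N T (\<lambda>_. n) C \<sigma> grad server"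
  define m where "m = measure P {y \<in> space P. (\<Sum>i<T. y i) > t}"
  have "is_loss_gradient (\<lambda>w \<xi>. w \<bullet> (if \<xi> = x then C *\<^sub>R b else 0)) grad"
    unfolding is_loss_gradient_def grad_def gderiv_def
    by (auto intro!: derivative_eq_intros)
  moreover have "is_server server" by (simp add: is_server_def server_def)
  ultimately have "differentially_private N \<epsilon> \<delta> M"
    using priv unfolding dp_sgd_private_def M_def by blast
  moreover have "adjacent (insert x d) d" using x d by (auto simp: adjacent_def)
  moreover have "A \<in> sets (M (insert x d))"
    unfolding M_def dp_sgd_def A_def by simp measurable
  ultimately have "measure (M (insert x d)) A \<le> exp \<epsilon> * measure (M d) A + \<delta>"
    using d unfolding differentially_private_def by blast
  moreover have "measure (M d) A = m"
    unfolding M_def A_def m_def grad_def P_def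
    by (rule measure_dp_sgd_without_record) (use assms b d x in auto)
  moreover have "exp e * m \<le> measure (M (insert x d)) A"
  proof -
    have "e = q * t / (C * \<sigma>\<^sup>2) - real T * q / (2 * \<sigma>\<^sup>2)"
      using assms by (simp add: e_def t_def field_simps power2_eq_square)
    then show ?thesis
      unfolding M_def A_def m_def grad_def P_def q_def
      using measure_dp_sgd_with_record[OF \<open>C > 0\<close> \<open>\<sigma> > 0\<close> b d(1) x \<open>n \<le> N\<close>] by simp
  qed
  moreover have "(exp e - exp \<epsilon>) * (exp (- (u + 1)\<^sup>2 / 2) / sqrt (2 * pi)) \<le> (exp e - exp \<epsilon>) * m"
    unfolding m_def P_def t_def using assms
    by (intro mult_left_mono normal_sum_tail_ge) auto
  ultimately show False using \<delta> by (simp add: algebra_simps)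
qed

section \<open>Recognising \<gamma> as a fixed point\<close>

text \<open>A fixed point is the least solution: a smaller \<open>\<gamma>'\<close> has a larger
  \<open>\<beta> = \<epsilon> / (\<gamma>' * k)\<close>, so by monotonicity its bound is at least
  \<open>gamma_bound \<sigma> \<alpha>\<close>, which exceeds \<open>\<gamma>'\<close>.\<close>

lemma is_gamma_gamma_bound:
  assumes "0 < \<alpha>" "\<alpha> < 1" "\<sigma> > 0" "\<sigma> * (1 - \<alpha>) - 2 * exp 1 * sqrt \<alpha> > 0"
    and "\<epsilon> > 0" "k > 0" "gamma_bound \<sigma> \<alpha> > 0" "\<epsilon> / (gamma_bound \<sigma> \<alpha> * k) = \<alpha>"
  shows "is_gamma \<epsilon> k \<sigma> (gamma_bound \<sigma> \<alpha>)"
  unfolding is_gamma_def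
proof (intro conjI allI impI)
  show "gamma_solution \<epsilon> k \<sigma> (gamma_bound \<sigma> \<alpha>)"
    using assms by (simp add: gamma_solution_def Let_def)
  fix \<gamma>' assume \<gamma>': "gamma_solution \<epsilon> k \<sigma> \<gamma>'"
  define \<beta> where "\<beta> = \<epsilon> / (\<gamma>' * k)"
  have \<beta>: "\<gamma>' > 0" "\<beta> < 1" "\<sigma> * (1 - \<beta>) - 2 * exp 1 * sqrt \<beta> > 0" "\<gamma>' \<ge> gamma_bound \<sigma> \<beta>"
    using \<gamma>' by (simp_all add: gamma_solution_def Let_def \<beta>_def)
  show "gamma_bound \<sigma> \<alpha> \<le> \<gamma>'"
  proof (rule ccontr)
    assume "\<not> gamma_bound \<sigma> \<alpha> \<le> \<gamma>'"
    then have "\<epsilon> / (gamma_bound \<sigma> \<alpha> * k) \<le> \<beta>"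
      unfolding \<beta>_def using assms \<beta>(1) by (intro divide_left_mono mult_right_mono mult_pos_pos) auto
    then have "gamma_bound \<sigma> \<alpha> \<le> gamma_bound \<sigma> \<beta>"
      using assms \<beta> by (intro gamma_bound_mono) auto
    then show False using \<beta>(4) \<open>\<not> gamma_bound \<sigma> \<alpha> \<le> \<gamma>'\<close> by simp
  qed
qed

section \<open>Choice of the parameters and verification\<close>

theorem theorem3p2:
  fixes a C :: real
  assumes "a > 4" and "C > 0" and "infinite (UNIV :: 'x set)"
  shows "\<exists>(N :: nat) (T :: nat) (s :: nat \<Rightarrow> nat) (\<epsilon> :: real) (\<delta> :: real) (\<sigma> :: real) (\<gamma> :: real).
    T > 0 \<and> (\<forall>i<T. 0 < s i \<and> s i \<le> N) \<and> \<epsilon> > 0 \<and> \<delta> > 0 \<and> \<sigma> > 0 \<and>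
    is_gamma \<epsilon> (epochs N T s) \<sigma> \<gamma> \<and> a > 2 * \<gamma> \<and>
    real T = 1 / a * (\<gamma> * (theta T s)\<^sup>2 * (epochs N T s)\<^sup>2 / \<epsilon>) \<and>
    \<sigma> = sqrt (2 * (\<epsilon> + ln (1 / \<delta>)) / \<epsilon>) \<and> \<delta> \<le> 1 / real N \<and> \<epsilon> < 0.5 \<and>
    N \<ge> 10000 \<and> theta T s \<le> 6.85 \<and>
    (2 / exp 1)\<^sup>2 * (epochs N T s)\<^sup>2 \<ge> 1 / 2 + ln (1 / \<delta>) \<and>
    \<not> dp_sgd_private TYPE('w::euclidean_space) TYPE('x) N T s C \<sigma> \<epsilon> \<delta>"
proof -
  \<comment> \<open>\<open>G p\<close> is the future \<gamma>, with \<open>p ^ 2\<close> as \<sigma>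
    and \<open>1 / (a * p ^ 3)\<close> as the value of \<alpha>.\<close>
  define G where "G p = gamma_bound (p ^ 2) (1 / (a * p ^ 3))" for p :: real
  have "((\<lambda>p::nat. G (real p)) \<longlongrightarrow> 2) at_top"
    unfolding G_def gamma_bound_def using \<open>a > 4\<close> by real_asymp
  then have "\<forall>\<^sub>F p in at_top. G (real p) < a / 2"
    by (rule order_tendstoD) (use \<open>a > 4\<close> in simp)
  moreover have "\<forall>\<^sub>F p::nat in at_top. 1 / (a * real p ^ 3) < 1"
    using \<open>a > 4\<close> by real_asymp
  moreover have "\<forall>\<^sub>F p::nat in at_top.
      real p ^ 2 * (1 - 1 / (a * real p ^ 3)) - 2 * exp 1 * sqrt (1 / (a * real p ^ 3)) > 0"
    using \<open>a > 4\<close> by real_asymp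
  \<comment> \<open>For \<open>\<delta> \<le> 1 / N\<close>: the left side is \<open>ln N\<close>,
    the right side a lower bound for \<open>ln (1 / \<delta>)\<close> once
    \<open>\<epsilon> > 2 / a\<close>.\<close>
  moreover have "\<forall>\<^sub>F p::nat in at_top. ln (10000 * real p ^ 3) \<le> (real p ^ 4 - 2) / a"
    using \<open>a > 4\<close> by real_asymp
  \<comment> \<open>The factors are a lower bound for \<open>exp e - exp \<epsilon>\<close>, the
    constant of the normal density, and a lower bound for the ratio of
    \<open>exp (- (u + 1)\<^sup>2 / 2)\<close> to \<delta>.\<close>
  moreover have "\<forall>\<^sub>F p::nat in at_top. (1 / (2 * a) - 1 / (2 * real p)) * (1 / sqrt (2 * pi)) *
      exp (7 / (32 * a) * real p ^ 4 - real p ^ 2 - 1) > 1"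
    using \<open>a > 4\<close> by real_asymp
  moreover have "\<forall>\<^sub>F p::nat in at_top. real p > a" by real_asymp
  ultimately have "\<forall>\<^sub>F p::nat in at_top. G (real p) < a / 2 \<and> 1 / (a * real p ^ 3) < 1 \<and>
      real p ^ 2 * (1 - 1 / (a * real p ^ 3)) - 2 * exp 1 * sqrt (1 / (a * real p ^ 3)) > 0 \<and>
      ln (10000 * real p ^ 3) \<le> (real p ^ 4 - 2) / a \<and>
      (1 / (2 * a) - 1 / (2 * real p)) * (1 / sqrt (2 * pi)) *
        exp (7 / (32 * a) * real p ^ 4 - real p ^ 2 - 1) > 1 \<and> real p > a"
    by eventually_elim auto
  then obtain p :: nat where G: "G (real p) < a / 2"
    and \<alpha>1: "1 / (a * real p ^ 3) < 1"
    and \<alpha>2: "real p ^ 2 * (1 - 1 / (a * real p ^ 3)) - 2 * exp 1 * sqrt (1 / (a * real p ^ 3)) > 0"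
    and lnN: "ln (10000 * real p ^ 3) \<le> (real p ^ 4 - 2) / a"
    and big: "(1 / (2 * a) - 1 / (2 * real p)) * (1 / sqrt (2 * pi)) *
        exp (7 / (32 * a) * real p ^ 4 - real p ^ 2 - 1) > 1"
    and pa: "real p > a"
    using eventually_happens'[OF sequentially_bot] by blast
  have p: "real p > 4" "p > 0" using pa \<open>a > 4\<close> by auto
  have p_ge1: "1 \<le> real p ^ j" for j using p by (intro one_le_power) auto

  \<comment> \<open>The common factor 10000 keeps the sample sizes integral at rate
    \<open>1 / p ^ 3\<close> and secures \<open>N \<ge> 10000\<close>.\<close>
  define N T n where "N = 10000 * p ^ 3" and "T = p ^ 6" and "n = (10000 :: nat)"
  define \<sigma> \<gamma> where "\<sigma> = real p ^ 2" and "\<gamma> = G (real p)"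
  define \<epsilon> where "\<epsilon> = \<gamma> / a"
  define \<delta> where "\<delta> = exp (- (\<epsilon> * (real p ^ 4 - 2) / 2))"
  define q where "q = real n / real N"
  have q: "q = 1 / real p ^ 3" using p by (simp add: q_def n_def N_def)
  have total: "total_samples T (\<lambda>_. n) = real T * real n"
    by (simp add: total_samples_def)
  have k: "epochs N T (\<lambda>_. n) = real p ^ 3"
    unfolding epochs_def total using p by (simp add: T_def N_def n_def field_simps flip: power_add)
  have "T > 0" "n > 0" using p by (auto simp: T_def n_def)
  have "max_sample T (\<lambda>_. n) = n"
    using \<open>T > 0\<close> by (simp add: max_sample_def image_constant_conv lessThan_empty_iff)
  then have \<theta>: "theta T (\<lambda>_. n) = 1"
    using \<open>T > 0\<close> \<open>n > 0\<close> by (simp add: theta_def mean_sample_def total)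
  have "\<sigma> > 0" using p by (simp add: \<sigma>_def)
  have G_bound: "\<gamma> = gamma_bound \<sigma> (1 / (a * real p ^ 3))" by (simp add: \<gamma>_def \<sigma>_def G_def)
  have "\<gamma> > 0"
    unfolding G_bound gamma_bound_def using \<alpha>1 \<alpha>2 p \<open>a > 4\<close> \<open>\<sigma> > 0\<close>
    by (intro add_pos_nonneg mult_nonneg_nonneg divide_nonneg_nonneg add_nonneg_nonneg divide_pos_pos)
       (auto simp: \<sigma>_def)
  then have "\<epsilon> > 0" using \<open>a > 4\<close> by (simp add: \<epsilon>_def)
  \<comment> \<open>The fixed-point equation: \<gamma> cancels because
    \<open>\<epsilon> = \<gamma> / a\<close>.\<close>
  have "\<epsilon> / (\<gamma> * real p ^ 3) = 1 / (a * real p ^ 3)"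
    using \<open>\<gamma> > 0\<close> by (simp add: \<epsilon>_def)
  then have is_gamma: "is_gamma \<epsilon> (real p ^ 3) \<sigma> \<gamma>"
    using \<alpha>1 \<alpha>2 p \<open>a > 4\<close> \<open>\<epsilon> > 0\<close> \<open>\<sigma> > 0\<close> \<open>\<gamma> > 0\<close> unfolding G_bound
    by (intro is_gamma_gamma_bound) (auto simp: \<sigma>_def)
  then have "\<gamma> > 2"
    using p \<open>\<epsilon> > 0\<close> \<open>\<sigma> > 0\<close> by (intro gamma_solution_gt_2[of \<epsilon> "real p ^ 3" \<sigma>]) (auto simp: is_gamma_def)
  have \<epsilon>: "\<epsilon> > 2 / a" "\<epsilon> < 1 / 2"
    using \<open>\<gamma> > 2\<close> G \<open>a > 4\<close> by (auto simp: \<epsilon>_def \<gamma>_def field_simps)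
  have ln_\<delta>: "ln (1 / \<delta>) = \<epsilon> * (real p ^ 4 - 2) / 2"
    by (simp add: \<delta>_def ln_div)
  have p4: "real p ^ 4 \<ge> 2"
    using power_mono[of 2 "real p" 4] p by simp

  have \<sigma>: "\<sigma> = sqrt (2 * (\<epsilon> + ln (1 / \<delta>)) / \<epsilon>)"
  proof -
    have "2 * (\<epsilon> + ln (1 / \<delta>)) / \<epsilon> = (real p ^ 2)\<^sup>2"
      unfolding ln_\<delta> using \<open>\<epsilon> > 0\<close> by (simp add: field_simps)
    then show ?thesis unfolding \<sigma>_def by (simp only: real_sqrt_abs abs_power2)
  qed
  have \<delta>_N: "\<delta> \<le> 1 / real N"
  proof -
    have "ln (real N) \<le> (real p ^ 4 - 2) / a" using lnN by (simp add: N_def)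
    also have "\<dots> = 2 / a * (real p ^ 4 - 2) / 2"
      using \<open>a > 4\<close> by (simp add: field_simps)
    also have "\<dots> \<le> \<epsilon> * (real p ^ 4 - 2) / 2"
      using \<epsilon> p4 by (intro divide_right_mono mult_right_mono) auto
    finally have "\<delta> \<le> exp (- ln (real N))" by (simp add: \<delta>_def)
    then show ?thesis using p by (simp add: N_def exp_minus inverse_eq_divide)
  qed
  \<comment> \<open>With \<open>\<epsilon> < 1 / 2\<close> the right side is at most
    \<open>p ^ 4 / 4\<close>, and \<open>exp 1 \<le> 3\<close> gives
    \<open>1 / 2 \<le> 2 / exp 1\<close>.\<close>
  have cond3: "(2 / exp 1)\<^sup>2 * (real p ^ 3)\<^sup>2 \<ge> 1 / 2 + ln (1 / \<delta>)"
  proof -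
    have "\<epsilon> * (real p ^ 4 - 2) \<le> 1 / 2 * (real p ^ 4 - 2)"
      using \<epsilon> p4 by (intro mult_right_mono) auto
    then have "1 / 2 + ln (1 / \<delta>) \<le> (1 / 2)\<^sup>2 * real p ^ 4"
      unfolding ln_\<delta> by (simp add: power2_eq_square)
    also have "\<dots> \<le> (2 / exp 1)\<^sup>2 * real p ^ 6"
      using exp_le p p_ge1[of 1] by (intro mult_mono power_mono power_increasing) (auto simp: field_simps)
    finally show ?thesis by (simp flip: power_mult)
  qed

  define u where "u = 5 / 4 * \<epsilon> * real p ^ 2"
  have "u \<ge> 0" using \<open>\<epsilon> > 0\<close> by (simp add: u_def)
  have sqrtT: "sqrt (real T) = real p ^ 3"
  proof -
    have "real T = (real p ^ 3)\<^sup>2" by (simp add: T_def flip: power_mult)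
    then show ?thesis by (simp only: real_sqrt_abs) simp
  qed
  \<comment> \<open>Since \<open>q * sqrt T = 1\<close>, the first term is
    \<open>u / \<sigma>\<close>; the second is \<open>p ^ 3 / (2 * p ^ 4)\<close>.\<close>
  have e: "q * u * sqrt (real T) / \<sigma> - real T * q / (2 * \<sigma>\<^sup>2) = 5 / 4 * \<epsilon> - 1 / (2 * real p)"
    using p unfolding sqrtT unfolding q u_def \<sigma>_def T_def by (simp add: field_simps eval_nat_numeral)
  have gap: "1 / (2 * a) - 1 / (2 * real p) \<le> 5 / 4 * \<epsilon> - 1 / (2 * real p) - \<epsilon>"
    using \<epsilon>(1) by simp
  have gap_pos: "0 < 1 / (2 * a) - 1 / (2 * real p)"
    using pa \<open>a > 4\<close> by (simp add: field_simps)
  have gap_nonneg: "\<epsilon> \<le> 5 / 4 * \<epsilon> - 1 / (2 * real p)"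
    using gap gap_pos by linarith
  \<comment> \<open>Factor out \<open>exp \<epsilon> \<ge> 1\<close> and use
    \<open>exp g \<ge> 1 + g\<close> for the gap \<open>g\<close>.\<close>
  have exp_gap: "1 / (2 * a) - 1 / (2 * real p) \<le> exp (5 / 4 * \<epsilon> - 1 / (2 * real p)) - exp \<epsilon>"
  proof -
    define g where "g = 5 / 4 * \<epsilon> - 1 / (2 * real p) - \<epsilon>"
    have g: "g \<ge> 0" "g \<le> exp g - 1"
      using gap gap_pos exp_ge_add_one_self[of g] unfolding g_def by linarith+
    then have "1 * g \<le> exp \<epsilon> * (exp g - 1)"
      using \<open>\<epsilon> > 0\<close> by (intro mult_mono) auto
    also have "\<dots> = exp (\<epsilon> + g) - exp \<epsilon>" by (simp add: algebra_simps exp_add)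
    also have "\<epsilon> + g = 5 / 4 * \<epsilon> - 1 / (2 * real p)" by (simp add: g_def)
    finally show ?thesis using gap by (simp add: g_def)
  qed
  \<comment> \<open>From \<open>\<epsilon> < 1 / 2\<close>, \<open>u\<^sup>2 / 2\<close> is at most
    25/64 of \<open>\<epsilon> * p ^ 4\<close>, while \<delta> has 32/64. The remaining 7/64, with
    \<open>\<epsilon> > 2 / a\<close>, yields \<open>7 / (32 * a)\<close>; \<open>p ^ 2\<close>
    absorbs \<open>u\<close>, and 1 absorbs \<open>\<epsilon> + 1 / 2\<close>.\<close>
  have exponent: "- (\<epsilon> * (real p ^ 4 - 2) / 2) + (7 / (32 * a) * real p ^ 4 - real p ^ 2 - 1) \<le> - (u + 1)\<^sup>2 / 2"
  proof -
    have "u\<^sup>2 = 25 / 16 * \<epsilon> * real p ^ 4 * \<epsilon>"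
      by (simp add: u_def power2_eq_square eval_nat_numeral)
    also have "\<dots> \<le> 25 / 16 * \<epsilon> * real p ^ 4 * (1 / 2)"
      using \<epsilon> \<open>\<epsilon> > 0\<close> by (intro mult_left_mono) auto
    finally have "u\<^sup>2 / 2 \<le> 25 / 64 * (\<epsilon> * real p ^ 4)" by simp
    moreover have "u \<le> 1 * real p ^ 2"
      unfolding u_def using \<epsilon> by (intro mult_right_mono) auto
    moreover have "7 / 64 * (2 / a * real p ^ 4) \<le> 7 / 64 * (\<epsilon> * real p ^ 4)"
      using \<epsilon> by (intro mult_left_mono mult_right_mono) auto
    moreover have "(u + 1)\<^sup>2 / 2 = u\<^sup>2 / 2 + u + 1 / 2"
      by (simp add: power2_eq_square field_simps)
    moreover have "7 / (32 * a) * real p ^ 4 = 7 / 64 * (2 / a * real p ^ 4)"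
      by simp
    moreover have "\<epsilon> * (real p ^ 4 - 2) / 2 = \<epsilon> * real p ^ 4 / 2 - \<epsilon>"
      by (simp add: field_simps)
    ultimately show ?thesis
      using \<epsilon>(2) unfolding minus_divide_left[symmetric] by linarith
  qed
  have "\<delta> < \<delta> * ((1 / (2 * a) - 1 / (2 * real p)) * (1 / sqrt (2 * pi)) *
      exp (7 / (32 * a) * real p ^ 4 - real p ^ 2 - 1))"
    using mult_strict_left_mono[OF big, of \<delta>] by (simp only: \<delta>_def exp_gt_zero mult_1_right)
  also have "\<dots> = (1 / (2 * a) - 1 / (2 * real p)) *
      (exp (- (\<epsilon> * (real p ^ 4 - 2) / 2) + (7 / (32 * a) * real p ^ 4 - real p ^ 2 - 1)) / sqrt (2 * pi))"
    unfolding \<delta>_def exp_add by simp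
  also have "\<dots> \<le> (exp (5 / 4 * \<epsilon> - 1 / (2 * real p)) - exp \<epsilon>) * (exp (- (u + 1)\<^sup>2 / 2) / sqrt (2 * pi))"
    using exponent exp_gap gap_nonneg by (intro mult_mono divide_right_mono) auto
  finally have not_private: "\<not> dp_sgd_private TYPE('w) TYPE('x) N T (\<lambda>_. n) C \<sigma> \<epsilon> \<delta>"
    using assms \<open>T > 0\<close> \<open>\<sigma> > 0\<close> \<open>u \<ge> 0\<close> gap_nonneg e[unfolded q_def] p p_ge1[of 3]
    by (intro not_dp_sgd_privateI[where u = u]) (auto simp: n_def N_def)
  have T_eq: "real T = 1 / a * (\<gamma> * (theta T (\<lambda>_. n))\<^sup>2 * (epochs N T (\<lambda>_. n))\<^sup>2 / \<epsilon>)"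
    unfolding \<theta> k using \<open>\<gamma> > 0\<close> \<open>a > 4\<close> by (simp add: \<epsilon>_def T_def flip: power_mult)
  have N: "\<forall>i<T. 0 < n \<and> n \<le> N" "N \<ge> 10000" and "\<delta> > 0" and "a > 2 * \<gamma>"
    and "theta T (\<lambda>_. n) \<le> 6.85" and "\<epsilon> < 0.5"
    unfolding \<theta> using p G \<epsilon> by (auto simp: n_def N_def \<delta>_def \<gamma>_def)
  show ?thesis
    by (rule exI[of _ N], rule exI[of _ T], rule exI[of _ "\<lambda>_. n"], rule exI[of _ \<epsilon>],
        rule exI[of _ \<delta>], rule exI[of _ \<sigma>], rule exI[of _ \<gamma>], intro conjI)
      (fact not_private T_eq N \<open>\<delta> > 0\<close> \<open>a > 2 * \<gamma>\<close> \<open>theta T (\<lambda>_. n) \<le> 6.85\<close> \<open>\<epsilon> < 0.5\<close>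
        \<open>T > 0\<close> \<open>\<epsilon> > 0\<close> \<open>\<sigma> > 0\<close> \<sigma> \<delta>_N is_gamma[folded k] cond3[folded k])+
qed

end
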